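(* For any positive integer $k$, $$\dim(F_k)=k \text{ and }\mathrm{edim}(F_k) = k + 2^k - 2.$$
   Context: For a positive integer $k$, $F_k$ is the graph on vertex set $A \cup B$, where $B = \{b_1, \ldots, b_k\}$ and $A = \{ a_S \mid S \subseteq B \}$; all pairs of distinct vertices of $B$ are adjacent, all pairs of distinct vertices of $A$ are adjacent, and $b_i\in B$, $a_S\in A$ are adjacent if and only if $b_i \in S$. Thus $|V(F_k)| = k + 2^k$. $\dim(G)$ is the (vertex) metric dimension: the minimum size of a set $S\subseteq V$ such that every pair of distinct vertices has different distance to some vertex of $S$. For an edge $e=xy$ and vertex $v$, $d(e,v)=\min\{d(x,v),d(y,v)\}$; $\mathrm{edim}(G)$ is the minimum size of a set $S\subseteq V$ such that every pair of distinct edges has different distance to some vertex of $S$. *)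

theory Defs
  imports Main "HOL-Library.Extended_Nat"
begin

text \<open>
  An undirected simple graph is given by its vertex set \<open>V\<close> and its edge set \<open>E\<close>, whose members
  are two-element subsets of \<open>V\<close>.
\<close>

definition adj_rel :: "'a set set \<Rightarrow> ('a \<times> 'a) set" where
  "adj_rel E = {(x, y). {x, y} \<in> E}"

text \<open>
  The members of \<open>adj_rel E ^^ n\<close> are the pairs joined by a walk with \<open>n\<close> edges. The infimum of the
  empty set is \<open>\<infinity>\<close>, so vertices in different components are at distance \<open>\<infinity>\<close>.
\<close>

definition graph_dist :: "'a set set \<Rightarrow> 'a \<Rightarrow> 'a \<Rightarrow> enat" where
  "graph_dist E x y = (INF n\<in>{n. (x, y) \<in> adj_rel E ^^ n}. enat n)"

text \<open>For an edge \<open>e = {x, y}\<close> the infimum is the minimum of the distances from \<open>x\<close> and \<open>y\<close>.\<close>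

definition edge_dist :: "'a set set \<Rightarrow> 'a set \<Rightarrow> 'a \<Rightarrow> enat" where
  "edge_dist E e v = (INF x\<in>e. graph_dist E x v)"

definition resolves_vertices :: "'a set \<Rightarrow> 'a set set \<Rightarrow> 'a set \<Rightarrow> bool" where
  "resolves_vertices V E S \<longleftrightarrow>
    (\<forall>x\<in>V. \<forall>y\<in>V. x \<noteq> y \<longrightarrow> (\<exists>s\<in>S. graph_dist E x s \<noteq> graph_dist E y s))"

definition resolves_edges :: "'a set set \<Rightarrow> 'a set \<Rightarrow> bool" where
  "resolves_edges E S \<longleftrightarrow>
    (\<forall>e\<in>E. \<forall>f\<in>E. e \<noteq> f \<longrightarrow> (\<exists>s\<in>S. edge_dist E e s \<noteq> edge_dist E f s))"

text \<open>
  The minima below are meant for finite graphs, where \<open>V\<close> itself resolves both the vertices and the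
  edges, so that the sets of sizes are nonempty.
\<close>

definition metric_dim :: "'a set \<Rightarrow> 'a set set \<Rightarrow> nat" where
  "metric_dim V E =
    (LEAST n. \<exists>S. S \<subseteq> V \<and> finite S \<and> resolves_vertices V E S \<and> card S = n)"

definition edge_metric_dim :: "'a set \<Rightarrow> 'a set set \<Rightarrow> nat" where
  "edge_metric_dim V E =
    (LEAST n. \<exists>S. S \<subseteq> V \<and> finite S \<and> resolves_edges E S \<and> card S = n)"

text \<open>
  Subsets of \<open>B = {b\<^sub>1, \<dots>, b\<^sub>k}\<close> are represented by their index sets: \<open>VA S\<close> with \<open>S \<subseteq> {1..k}\<close> is the
  vertex of \<open>A\<close> belonging to \<open>{b\<^sub>i | i \<in> S}\<close>.
\<close>

datatype F_vertex = VB nat | VA "nat set"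

definition F_verts :: "nat \<Rightarrow> F_vertex set" where
  "F_verts k = VB ` {1..k} \<union> VA ` Pow {1..k}"

definition F_edges :: "nat \<Rightarrow> F_vertex set set" where
  "F_edges k =
    {{VB i, VB j} | i j. i \<in> {1..k} \<and> j \<in> {1..k} \<and> i \<noteq> j} \<union>
    {{VA S, VA T} | S T. S \<subseteq> {1..k} \<and> T \<subseteq> {1..k} \<and> S \<noteq> T} \<union>
    {{VB i, VA S} | i S. i \<in> {1..k} \<and> S \<subseteq> {1..k} \<and> i \<in> S}"

end

theory Submission
  imports Defs
begin

text \<open>
  The vertex \<open>u = a\<^sub>B\<close> is adjacent to every other vertex, so distances are at most 2.
  Vertices of \<open>A\<close> outside a resolving set \<open>R\<close> are told apart only by their
  neighbourhoods in \<open>R \<inter> B\<close>, whence \<open>2\<^sup>k - |R \<inter> A| \<le> 2 ^ |R \<inter> B|\<close>, which forces \<open>|R| \<ge> k\<close>; the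
  set \<open>B\<close> resolves. Two edges \<open>ux\<close>, \<open>uy\<close> are told apart only by \<open>x\<close> and \<open>y\<close>, so an edge resolving set
  misses at most one vertex besides \<open>u\<close>; omitting exactly \<open>u\<close> and \<open>a\<^sub>\<emptyset>\<close> works.
\<close>

section \<open>Distances in graphs with a dominating vertex\<close>

text \<open>Over \<open>enat\<close> the bound by \<open>n\<close> is the strict bound by
  \<open>Suc n\<close>, and an infimum lies strictly below a value iff some member does; this turns
  distances into walks.\<close>

lemma graph_dist_le_iff:
  "graph_dist E x y \<le> enat n \<longleftrightarrow> (\<exists>m\<le>n. (x, y) \<in> adj_rel E ^^ m)"
proof
  assume "graph_dist E x y \<le> enat n"
  then have "graph_dist E x y < enat (Suc n)"
    by (meson enat_ord_simps(2) le_less_trans lessI)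
  then show "\<exists>m\<le>n. (x, y) \<in> adj_rel E ^^ m"
    unfolding graph_dist_def INF_less_iff by (auto simp: less_Suc_eq_le)
next
  assume "\<exists>m\<le>n. (x, y) \<in> adj_rel E ^^ m"
  then obtain m where "m \<le> n" "(x, y) \<in> adj_rel E ^^ m" by blast
  then show "graph_dist E x y \<le> enat n"
    unfolding graph_dist_def by (intro INF_lower2[of m]) auto
qed

lemma graph_dist_le_0_iff: "graph_dist E x y \<le> 0 \<longleftrightarrow> x = y"
  using graph_dist_le_iff[of E x y 0] by (simp add: zero_enat_def)

lemma graph_dist_le_1_iff: "graph_dist E x y \<le> 1 \<longleftrightarrow> x = y \<or> {x, y} \<in> E"
  using graph_dist_le_iff[of E x y 1]
  by (auto simp: one_enat_def le_Suc_eq adj_rel_def)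

lemma graph_dist_dominating:
  assumes dom: "\<And>v. v \<in> V \<Longrightarrow> v \<noteq> u \<Longrightarrow> {u, v} \<in> E"
    and "x \<in> V" "y \<in> V"
  shows "graph_dist E x y = (if x = y then 0 else if {x, y} \<in> E then 1 else 2)"
proof -
  have two: "graph_dist E x y \<le> 2" if "x \<noteq> y" "{x, y} \<notin> E"
  proof -
    \<comment> \<open>Neither \<open>x\<close> nor \<open>y\<close> is \<open>u\<close>, since
      \<open>u\<close> is adjacent to all other vertices; so there is a walk \<open>x\<close>,
      \<open>u\<close>, \<open>y\<close>.\<close>
    have "{x, u} \<in> E" "{u, y} \<in> E"
      using that assms by (metis insert_commute)+
    then have "(x, y) \<in> adj_rel E ^^ 2"
      by (auto simp: numeral_2_eq_2 adj_rel_def)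
    then have "graph_dist E x y \<le> enat 2"
      unfolding graph_dist_le_iff by (intro exI[of _ 2] conjI order_refl)
    then show ?thesis by (simp add: numeral_eq_enat)
  qed
  have one: "1 \<le> d" if "\<not> d \<le> 0" for d :: enat
    using that by (cases d) (auto simp: zero_enat_def one_enat_def)
  have eq2: "d = 2" if "d \<le> 2" "\<not> d \<le> 1" for d :: enat
    using that by (cases d) (auto simp: one_enat_def numeral_eq_enat)
  consider "x = y" | "x \<noteq> y" "{x, y} \<in> E" | "x \<noteq> y" "{x, y} \<notin> E" by blast
  then show ?thesis
  proof cases
    case 1
    then show ?thesis using graph_dist_le_0_iff[of E x y] by simp
  next
    case 2
    then have "graph_dist E x y \<le> 1" "1 \<le> graph_dist E x y"
      using one graph_dist_le_0_iff[of E x y] graph_dist_le_1_iff[of E x y] by simp_all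
    then show ?thesis using 2 by simp
  next
    case 3
    then have "graph_dist E x y = 2"
      using two eq2 graph_dist_le_1_iff[of E x y] by blast
    then show ?thesis using 3 by simp
  qed
qed

lemma edge_dist_pair: "edge_dist E {x, y} v = min (graph_dist E x v) (graph_dist E y v)"
  by (simp add: edge_dist_def inf_min)

lemma edge_dist_le_0_iff:
  "edge_dist E {x, y} v \<le> 0 \<longleftrightarrow> v \<in> {x, y}"
  by (auto simp: edge_dist_pair min_le_iff_disj graph_dist_le_0_iff simp del: le_zero_eq)

lemma edge_dist_le_1_iff:
  "edge_dist E {x, y} v \<le> 1 \<longleftrightarrow> v \<in> {x, y} \<or> {x, v} \<in> E \<or> {y, v} \<in> E"
  by (auto simp: edge_dist_pair min_le_iff_disj graph_dist_le_1_iff)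

text \<open>A vertex \<open>s\<close> other than \<open>x\<close>, \<open>y\<close> and
  \<open>u\<close> is at distance 1 from both \<open>{u, x}\<close> and \<open>{u, y}\<close>,
  because \<open>u\<close> already attains the minimum; \<open>u\<close> itself is at distance 0
  from both. Only \<open>x\<close> and \<open>y\<close> can separate these edges.\<close>

lemma resolves_edges_dominating:
  assumes dom: "\<And>v. v \<in> V \<Longrightarrow> v \<noteq> u \<Longrightarrow> {u, v} \<in> E"
    and res: "resolves_edges E R" and "R \<subseteq> V" "u \<in> V"
    and x: "x \<in> V - {u}" and y: "y \<in> V - {u}" and "x \<noteq> y"
  shows "x \<in> R \<or> y \<in> R"
proof (rule ccontr)
  assume "\<not> (x \<in> R \<or> y \<in> R)"
  have const: "edge_dist E {u, z} s = (if s = u then 0 else 1)"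
    if "s \<in> R" "z \<in> V" "s \<noteq> z" for s z
    using that graph_dist_dominating[OF dom, where V = V] \<open>R \<subseteq> V\<close> \<open>u \<in> V\<close> dom[of s]
    by (auto simp: edge_dist_pair subset_iff)
  have "{u, x} \<noteq> {u, y}" using x y \<open>x \<noteq> y\<close> by (auto simp: doubleton_eq_iff)
  moreover have "{u, x} \<in> E" "{u, y} \<in> E" using dom x y by simp_all
  ultimately obtain s where s: "s \<in> R" "edge_dist E {u, x} s \<noteq> edge_dist E {u, y} s"
    using res unfolding resolves_edges_def by meson
  then have "s \<noteq> x" "s \<noteq> y" using \<open>\<not> (x \<in> R \<or> y \<in> R)\<close> by blast+
  then show False
    using const[of s x] const[of s y] x y s by simp
qed

lemma card_resolves_edges_dominating:
  assumes "finite V"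
    and dom: "\<And>v. v \<in> V \<Longrightarrow> v \<noteq> u \<Longrightarrow> {u, v} \<in> E"
    and "resolves_edges E R" "R \<subseteq> V" "u \<in> V"
  shows "card V - 2 \<le> card R"
proof -
  \<comment> \<open>Any two vertices missed by \<open>R\<close> and different from \<open>u\<close>
    coincide, by the previous lemma.\<close>
  have "card (V - {u} - R) \<le> 1"
    using resolves_edges_dominating[OF dom assms(3-5)] \<open>finite V\<close>
    by (auto simp: card_le_Suc0_iff_eq)
  moreover have "V \<subseteq> insert u R \<union> (V - {u} - R)" by blast
  then have "card V \<le> card (insert u R \<union> (V - {u} - R))"
    using assms by (intro card_mono) (auto intro: finite_subset)
  moreover have "card (insert u R \<union> (V - {u} - R)) \<le> card (insert u R) + card (V - {u} - R)"
    by (rule card_Un_le)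
  moreover have "card (insert u R) \<le> Suc (card R)"
    by (rule card_insert_le_m1) simp_all
  ultimately show ?thesis by linarith
qed

section \<open>The graph \<open>F\<^sub>k\<close>\<close>

lemma finite_F_verts: "finite (F_verts k)"
  by (simp add: F_verts_def)

lemma card_F_verts: "card (F_verts k) = k + 2 ^ k"
proof -
  have "card (F_verts k) = card (VB ` {1..k}) + card (VA ` Pow {1..k})"
    unfolding F_verts_def by (intro card_Un_disjoint) auto
  also have "\<dots> = k + 2 ^ k"
    by (subst (1 2) card_image) (auto simp: inj_on_def card_Pow)
  finally show ?thesis .
qed

lemma F_edges_simps:
  "{VA S, VA T} \<in> F_edges k \<longleftrightarrow> S \<subseteq> {1..k} \<and> T \<subseteq> {1..k} \<and> S \<noteq> T"
  "{VB i, VB j} \<in> F_edges k \<longleftrightarrow> i \<in> {1..k} \<and> j \<in> {1..k} \<and> i \<noteq> j"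
  "{VA S, VB i} \<in> F_edges k \<longleftrightarrow> S \<subseteq> {1..k} \<and> i \<in> {1..k} \<and> i \<in> S"
  "{VB i, VA S} \<in> F_edges k \<longleftrightarrow> S \<subseteq> {1..k} \<and> i \<in> {1..k} \<and> i \<in> S"
  by (auto simp: F_edges_def doubleton_eq_iff)

lemma F_edgesE:
  assumes "e \<in> F_edges k"
  obtains x y where "e = {x, y}" "x \<noteq> y" "x \<in> F_verts k" "y \<in> F_verts k"
  using assms unfolding F_edges_def F_verts_def by blast

lemma F_dominating:
  "v \<in> F_verts k \<Longrightarrow> v \<noteq> VA {1..k} \<Longrightarrow> {VA {1..k}, v} \<in> F_edges k"
  by (auto simp: F_verts_def F_edges_simps)

lemma graph_dist_F:
  assumes "x \<in> F_verts k" "y \<in> F_verts k"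
  shows "graph_dist (F_edges k) x y = (if x = y then 0 else if {x, y} \<in> F_edges k then 1 else 2)"
  by (rule graph_dist_dominating[of "F_verts k" "VA {1..k}"]) (use F_dominating assms in blast)+

section \<open>Vertex metric dimension of \<open>F_k\<close>\<close>

lemma resolves_vertices_F: "resolves_vertices (F_verts k) (F_edges k) (VB ` {1..k})"
  unfolding resolves_vertices_def
proof (intro ballI impI)
  fix x y assume xy: "x \<in> F_verts k" "y \<in> F_verts k" "x \<noteq> y"
  have B: "VB i \<in> F_verts k" if "i \<in> {1..k}" for i
    using that by (simp add: F_verts_def)
  note d = graph_dist_F[OF xy(1) B] graph_dist_F[OF xy(2) B]
  \<comment> \<open>A vertex of \<open>B\<close> is recognised by its distance 0 to itself; two
    vertices of \<open>A\<close> are separated by any \<open>VB i\<close> with \<open>i\<close> in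
    the symmetric difference of their sets.\<close>
  consider i where "i \<in> {1..k}" "x = VB i \<or> y = VB i"
    | S T where "x = VA S" "y = VA T" "S \<subseteq> {1..k}" "T \<subseteq> {1..k}" "S \<noteq> T"
    using xy unfolding F_verts_def by blast
  then show "\<exists>s\<in>VB ` {1..k}. graph_dist (F_edges k) x s \<noteq> graph_dist (F_edges k) y s"
  proof cases
    case 1
    then show ?thesis using d[of i] xy(3) by (intro bexI[of _ "VB i"]) auto
  next
    case 2
    then obtain i where "i \<in> {1..k}" "i \<in> S \<longleftrightarrow> i \<notin> T" by blast
    then show ?thesis
      using d[of i] 2 by (intro bexI[of _ "VB i"]) (auto simp: F_edges_simps)
  qed
qed

lemma card_resolves_vertices_F:
  assumes res: "resolves_vertices (F_verts k) (F_edges k) R" and "R \<subseteq> F_verts k"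
  shows "k \<le> card R"
proof (rule ccontr)
  assume "\<not> k \<le> card R"
  then obtain m where k: "k = Suc m" and cR: "card R \<le> m"
    by (cases k) auto
  define P where "P = {S. VA S \<in> R}"
  define Q where "Q = {i. VB i \<in> R}"
  have "finite R" using assms finite_F_verts finite_subset by blast
  then have fin: "finite P" "finite Q"
    unfolding P_def Q_def
    using finite_vimageI[of R VA] finite_vimageI[of R VB] by (simp_all add: inj_on_def vimage_def)
  have "card (VA ` P) \<le> card R" "card (VB ` Q) \<le> card R"
    using \<open>finite R\<close> by (auto intro!: card_mono simp: P_def Q_def)
  \<comment> \<open>Bounding the two parts of \<open>R\<close> separately is enough:
    \<open>2 * 2 ^ m - m\<close> still exceeds \<open>2 ^ m\<close>.\<close>
  then have card_PQ: "card P \<le> m" "card Q \<le> m"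
    using cR by (auto simp: card_image inj_on_def)
  \<comment> \<open>\<open>A\<close> is a clique, so each \<open>VA U\<close> in \<open>R\<close> is
    at distance 1 from every \<open>VA S\<close> with \<open>S\<close> outside \<open>P\<close>.
    Only the \<open>VB i\<close> with \<open>i\<close> in \<open>Q\<close> can separate such
    vertices, and they see just the trace on \<open>Q\<close>.\<close>
  have inj: "inj_on (\<lambda>S. S \<inter> Q) (Pow {1..k} - P)"
  proof (rule inj_onI, rule ccontr)
    fix S T
    assume S: "S \<in> Pow {1..k} - P" and T: "T \<in> Pow {1..k} - P"
      and eq: "S \<inter> Q = T \<inter> Q" and "S \<noteq> T"
    have V: "VA S \<in> F_verts k" "VA T \<in> F_verts k"
      using S T by (auto simp: F_verts_def)
    then obtain s where s: "s \<in> R" "graph_dist (F_edges k) (VA S) s \<noteq> graph_dist (F_edges k) (VA T) s"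
      using res \<open>S \<noteq> T\<close> unfolding resolves_vertices_def by blast
    have sV: "s \<in> F_verts k" using s \<open>R \<subseteq> F_verts k\<close> by blast
    show False
    proof (cases s)
      case (VA U)
      then show ?thesis
        using s sV S T graph_dist_F[OF V(1) sV] graph_dist_F[OF V(2) sV]
        by (auto simp: F_edges_simps P_def F_verts_def split: if_splits)
    next
      case (VB i)
      then have "i \<in> S \<longleftrightarrow> i \<in> T" using s eq by (auto simp: Q_def)
      then show ?thesis
        using VB s sV S T graph_dist_F[OF V(1) sV] graph_dist_F[OF V(2) sV]
        by (auto simp: F_edges_simps split: if_splits)
    qed
  qed
  have "card (Pow {1..k} - P) \<le> card (Pow Q)"
    using inj fin by (intro card_inj_on_le) auto
  also have "\<dots> \<le> 2 ^ m"
    using fin card_PQ by (simp add: card_Pow)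
  finally have "card (Pow {1..k} - P) \<le> 2 ^ m" .
  moreover have "card (Pow {1..k}) - card P \<le> card (Pow {1..k} - P)"
    by (rule diff_card_le_card_Diff[OF fin(1)])
  moreover have "card (Pow {1..k}) = 2 * 2 ^ m" by (simp add: card_Pow k)
  moreover have "m < 2 ^ m" by (rule less_exp)
  ultimately show False using card_PQ by linarith
qed

lemma metric_dim_F: "metric_dim (F_verts k) (F_edges k) = k"
  unfolding metric_dim_def
proof (rule Least_equality)
  have "card (VB ` {1..k}) = k" by (simp add: card_image inj_on_def)
  then show "\<exists>S\<subseteq>F_verts k. finite S \<and> resolves_vertices (F_verts k) (F_edges k) S \<and> card S = k"
    using resolves_vertices_F by (intro exI[of _ "VB ` {1..k}"]) (auto simp: F_verts_def)
qed (use card_resolves_vertices_F in blast)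

section \<open>Edge metric dimension of \<open>F_k\<close>\<close>

text \<open>Two different pairs with the same trace outside \<open>{u, z}\<close> must each have
  exactly one element there: with none or two inside, one pair would determine the other.\<close>

lemma doubletons_eq_outside:
  assumes "{a, b} \<noteq> {c, d}" "a \<noteq> b" "c \<noteq> d" and eq: "{a, b} - {u, z} = {c, d} - {u, z}"
  shows "\<exists>x. x \<noteq> u \<and> x \<noteq> z \<and>
    ({a, b} = {x, u} \<and> {c, d} = {x, z} \<or> {a, b} = {x, z} \<and> {c, d} = {x, u})"
proof -
  have split: "\<exists>x y. {p, q} = {x, y} \<and> x \<notin> {u, z} \<and> y \<in> {u, z}"
    if "{p, q} \<noteq> {r, s}" "p \<noteq> q" "r \<noteq> s" "{p, q} - {u, z} = {r, s} - {u, z}" for p q r s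
  proof -
    consider "p \<in> {u, z}" "q \<in> {u, z}" | "p \<notin> {u, z}" "q \<in> {u, z}"
      | "p \<in> {u, z}" "q \<notin> {u, z}" | "p \<notin> {u, z}" "q \<notin> {u, z}" by blast
    then show ?thesis
    proof cases
      case 1
      then have "r \<in> {u, z}" "s \<in> {u, z}" using that(4) by blast+
      then have "{p, q} = {r, s}" using 1 that(2,3) by auto
      then show ?thesis using that(1) by simp
    next
      case 4
      then have "p \<in> {r, s}" "q \<in> {r, s}" using that(4) by blast+
      then have "{p, q} = {r, s}" using that(2) by auto
      then show ?thesis using that(1) by simp
    qed (metis insert_commute)+
  qed
  obtain x y where xy: "{a, b} = {x, y}" "x \<notin> {u, z}" "y \<in> {u, z}"
    using split[OF assms] by blast
  obtain x' y' where xy': "{c, d} = {x', y'}" "x' \<notin> {u, z}" "y' \<in> {u, z}"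
    using split[OF assms(1)[symmetric] assms(3,2) eq[symmetric]] by blast
  have "x' = x" using eq unfolding xy(1) xy'(1) using xy(2,3) xy'(2,3) by blast
  then show ?thesis using assms(1) xy xy' by (intro exI[of _ x]) auto
qed

text \<open>Distance 0 reveals all endpoints except \<open>VA {1..k}\<close> and
  \<open>VA {}\<close>, so the only edges left to separate are those joining a common
  \<open>x\<close> to these two vertices.\<close>

lemma resolves_edges_F:
  "resolves_edges (F_edges k) (F_verts k - {VA {1..k}, VA {}})"
  (is "resolves_edges ?E ?S")
  unfolding resolves_edges_def
proof (intro ballI impI, rule ccontr)
  fix e f
  assume ef: "e \<in> ?E" "f \<in> ?E" "e \<noteq> f"
    and "\<not> (\<exists>s\<in>?S. edge_dist ?E e s \<noteq> edge_dist ?E f s)"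
  then have same: "edge_dist ?E e s = edge_dist ?E f s" if "s \<in> ?S" for s
    using that by blast
  let ?u = "VA {1..k}" and ?z = "VA {}"
  obtain a b where e: "e = {a, b}" "a \<noteq> b" "a \<in> F_verts k" "b \<in> F_verts k"
    using ef(1) by (rule F_edgesE)
  obtain c d where f: "f = {c, d}" "c \<noteq> d" "c \<in> F_verts k" "d \<in> F_verts k"
    using ef(2) by (rule F_edgesE)
  have ends: "s \<in> e \<longleftrightarrow> s \<in> f" if "s \<in> ?S" for s
    using same[OF that] edge_dist_le_0_iff[of ?E a b s] edge_dist_le_0_iff[of ?E c d s] e f by simp
  have diff: "e - {?u, ?z} = f - {?u, ?z}"
    using ends e f by blast
  have key: False
    if g: "{x, ?u} \<in> ?E" "{x, ?z} \<in> ?E" "x \<noteq> ?u" "x \<noteq> ?z"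
      and eq: "\<And>s. s \<in> ?S \<Longrightarrow> edge_dist ?E {x, ?u} s = edge_dist ?E {x, ?z} s" for x
  proof -
    \<comment> \<open>\<open>VA {}\<close> has no neighbour in \<open>B\<close>, so \<open>x\<close>
      lies in \<open>A\<close>; being different from \<open>VA {1..k}\<close>, it misses some
      \<open>VB i\<close>. This \<open>VB i\<close> is adjacent to \<open>VA {1..k}\<close> but to
      neither \<open>x\<close> nor \<open>VA {}\<close>.\<close>
    obtain T where T: "x = VA T" "T \<subseteq> {1..k}"
      using g(2) by (cases x) (auto simp: F_edges_simps)
    then obtain i where i: "i \<in> {1..k}" "i \<notin> T" using g(3) by blast
    then have "VB i \<in> ?S" by (simp add: F_verts_def)
    moreover have "edge_dist ?E {x, ?u} (VB i) \<le> 1"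
      unfolding edge_dist_le_1_iff using i by (auto simp: F_edges_simps)
    moreover have "\<not> edge_dist ?E {x, ?z} (VB i) \<le> 1"
      unfolding edge_dist_le_1_iff using i T by (auto simp: F_edges_simps)
    ultimately show False using eq by metis
  qed
  have "\<exists>x. x \<noteq> ?u \<and> x \<noteq> ?z \<and> (e = {x, ?u} \<and> f = {x, ?z} \<or> e = {x, ?z} \<and> f = {x, ?u})"
    unfolding e(1) f(1)
    by (rule doubletons_eq_outside[OF ef(3)[unfolded e(1) f(1)] e(2) f(2) diff[unfolded e(1) f(1)]])
  then obtain x where x: "x \<noteq> ?u" "x \<noteq> ?z"
    "e = {x, ?u} \<and> f = {x, ?z} \<or> e = {x, ?z} \<and> f = {x, ?u}" by blast
  have "{x, ?u} \<in> ?E" "{x, ?z} \<in> ?E" using x(3) ef(1,2) by metis+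
  moreover have "edge_dist ?E {x, ?u} s = edge_dist ?E {x, ?z} s" if "s \<in> ?S" for s
    using x(3) same[OF that] by metis
  ultimately show False using key[OF _ _ x(1,2)] by blast
qed

lemma edge_metric_dim_F:
  assumes "k \<ge> 1"
  shows "edge_metric_dim (F_verts k) (F_edges k) = k + 2 ^ k - 2"
  unfolding edge_metric_dim_def
proof (rule Least_equality)
  let ?S = "F_verts k - {VA {1..k}, VA {}}"
  \<comment> \<open>Here \<open>k \<ge> 1\<close> keeps the two omitted vertices distinct, so
    exactly two are removed.\<close>
  have "VA {1..k} \<in> F_verts k" "VA {} \<in> F_verts k" "VA {1..k} \<noteq> VA {}"
    using assms by (auto simp: F_verts_def)
  then have "card ?S = k + 2 ^ k - 2"
    by (subst card_Diff_subset) (auto simp: card_F_verts)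
  then show "\<exists>S\<subseteq>F_verts k. finite S \<and> resolves_edges (F_edges k) S \<and> card S = k + 2 ^ k - 2"
    using resolves_edges_F by (intro exI[of _ ?S]) (auto simp: finite_F_verts)
next
  fix n
  assume "\<exists>S\<subseteq>F_verts k. finite S \<and> resolves_edges (F_edges k) S \<and> card S = n"
  then obtain S where "S \<subseteq> F_verts k" "resolves_edges (F_edges k) S" "card S = n" by blast
  then show "k + 2 ^ k - 2 \<le> n"
    using card_resolves_edges_dominating[of "F_verts k" "VA {1..k}" "F_edges k" S] F_dominating
    by (simp add: card_F_verts finite_F_verts) (auto simp: F_verts_def)
qed

theorem theorem3p7:
  fixes k :: nat
  assumes "k \<ge> 1"
  shows "metric_dim (F_verts k) (F_edges k) = k \<and>
         edge_metric_dim (F_verts k) (F_edges k) = k + 2 ^ k - 2"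
  using metric_dim_F edge_metric_dim_F[OF assms] by blast

end
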